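(* Let $\gamma\subset\mathbb{C}$ be a finite union of piecewise smooth, oriented curves, let $W$ be a rational $r\times r$ matrix weight, and let $N\in\mathbb{N}_{>0}$. Suppose that $W$ has no pole on $\gamma$, that $W(z)$ is diagonalizable for all but finitely many $z\in\mathbb{C}$, and that the Christoffel--Darboux kernel $\mathcal{R}_N^W$ exists. Let $\mathcal{M}$ be an $r$-sheeted Riemann surface such that the functions $\lambda$, $\mathfrak{e}$, $\widehat{\mathfrak{e}}$ (built from the eigenvalues of $W$, the columns of $E$ and the rows of $E^{-1}$, see context) are meromorphic on $\mathcal{M}$, and define $$R_N^{\lambda}(\mathrm{w},\mathrm{z})=\widehat{\mathfrak{e}}(\mathrm{w})\,\mathcal{R}_N^W(w,z)\,\mathfrak{e}(\mathrm{z}),\qquad \mathrm{z}\in\mathcal{M}_*\setminus\mathcal{Q},\ \mathrm{w}\in\mathcal{M}_*\setminus\widehat{\mathcal{Q}}.$$ Let $$L_N=\{\mathrm{z}\mapsto P(z)\mathfrak{e}(\mathrm{z}):P\in\mathcal{P}_{N-1}^{1\times r}\},\qquad \widehat{L}_N=\{\mathrm{z}\mapsto\widehat{\mathfrak{e}}(\mathrm{z})P(z):P\in\mathcal{P}_{N-1}^{r\times1}\}.$$ Then $R_N^\lambda$ exists, $\dim L_N=\dim\widehat{L}_N=rN$, and we have the following: (a) $\mathrm{z}\mapsto R_N^\lambda(\mathrm{w},\mathrm{z})$ belongs to $L_N$ for every $\mathrm{w}\in\mathcal{M}_*\setminus\widehat{\mathcal{Q}}$; (b) $\mathrm{w}\mapsto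 R_N^\lambda(\mathrm{w},\mathrm{z})$ belongs to $\widehat{L}_N$ for every $\mathrm{z}\in\mathcal{M}_*\setminus\mathcal{Q}$; (c) $R_N^\lambda$ satisfies the following reproducing property for $L_N$: for every $f\in L_N$ and every $\mathrm{z}\in\mathcal{M}_*\setminus\mathcal{Q}$, $$\int_{\gamma_{\mathcal{M}}}f(\mathrm{w})\lambda(\mathrm{w})R_N^\lambda(\mathrm{w},\mathrm{z})\,dw=f(\mathrm{z});$$ (d) $R_N^\lambda$ satisfies the following reproducing property for $\widehat{L}_N$: for every $f\in\widehat{L}_N$ and every $\mathrm{w}\in\mathcal{M}_*\setminus\widehat{\mathcal{Q}}$, $$\int_{\gamma_{\mathcal{M}}}R_N^\lambda(\mathrm{w},\mathrm{z})\lambda(\mathrm{z})f(\mathrm{z})\,dz=f(\mathrm{w}).$$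
   Context: **Polynomial spaces.** $\mathcal{P}_{N-1}^{j\times k}$ is the vector space of all $j\times k$ matrix polynomials $\sum_{\ell=0}^{N-1}C_\ell z^\ell$, $C_\ell\in\mathbb{C}^{j\times k}$. **CD kernel.** Given $\gamma$, $W$, $N$, the Christoffel--Darboux (CD) kernel $\mathcal{R}_N^W(w,z)$ is the unique (when it exists) bivariate $r\times r$ matrix polynomial of degree $\le N-1$ in both $w$ and $z$ that satisfies either $\int_\gamma P(w)W(w)\mathcal{R}_N^W(w,z)dw=P(z)$ for every $P\in\mathcal{P}_{N-1}^{r\times r}$ and $z\in\mathbb{C}$, or $\int_\gamma\mathcal{R}_N^W(w,z)W(z)P(z)dz=P(w)$ for every $P\in\mathcal{P}_{N-1}^{r\times r}$ and $w\in\mathbb{C}$ (one of the two properties is sufficient to determine it uniquely). **Riemann surface and the functions $\lambda,\mathfrak{e},\widehat{\mathfrak{e}}$.** For all but finitely many $z\in\mathbb{C}$ write $W(z)=E(z)\Lambda(z)E(z)^{-1}$ with $\Lambda(z)=\mathrm{diag}(\lambda_1(z),\dots,\lambda_r(z))$ and $E(z)$ an invertible matrix of eigenvectors. $\mathcal{M}$ is a compact (possibly disconnected) Riemann surface represented as an $r$-sheeted covering of $\widehat{\mathbb{C}}=\mathbb{C}\cup\{\infty\}$. Points of $\mathcal{M}$ are denoted $\mathrm{z},\mathrm{w}$, and $z,w$ denote their projections on $\widehat{\mathbb{C}}$. With $e_k$ the $k$-th column of the $r\times r$ identity matrix, define for $\mathrm{z}$ on the $k$-th sheet $$\lambda(\mathrm{z})=\lambda_k(z),\qquad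 \mathfrak{e}(\mathrm{z})=E(z)e_k,\qquad \widehat{\mathfrak{e}}(\mathrm{z})=e_k^TE(z)^{-1}.$$ The surface $\mathcal{M}$, the numbering of its sheets, and the matrix $E$ are chosen so that these functions are (entrywise) meromorphic on $\mathcal{M}$; such a choice exists under the hypotheses on $W$. **Other notation.** $\mathcal{M}_*$ is $\mathcal{M}$ with all points at infinity removed. $\mathcal{Q}$ and $\widehat{\mathcal{Q}}$ are the finite sets of all poles of $\mathfrak{e}$ and $\widehat{\mathfrak{e}}$, respectively (a point is a pole if it is a pole of at least one entry). $\gamma_{\mathcal{M}}=\bigcup_{j=1}^r\gamma^{(j)}$ is the contour on $\mathcal{M}$ that consists of $r$ copies of $\gamma$, one on each sheet.
   Formalization: The integral over the contour on the surface is read as the integral over γ of the sum over the r sheets, since the integrals over single sheets may diverge (e.g. when γ passes through the projection of a pole of e or ê); where they all exist, the two readings agree. *)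

theory Defs
  imports
    "HOL-Complex_Analysis.Complex_Analysis"
    "HOL-Library.Function_Algebras"
begin

no_notation fps_nth (infixl \<open>$\<close> 75)

section \<open>Contours and rational matrix weights\<close>

text \<open>
  An oriented curve is a parametrisation together with its parameter interval, which may be
  unbounded or not closed, so that curves running to infinity are covered; \<^const>\<open>valid_path\<close> is
  the case of the interval \<open>{0..1}\<close>.  A contour is a finite list of such curves.
\<close>

type_synonym curve = "(real \<Rightarrow> complex) \<times> real set"

definition piecewise_smooth_contour :: "curve list \<Rightarrow> bool" where
  "piecewise_smooth_contour \<Gamma> \<longleftrightarrow>
     (\<forall>(g, J) \<in> set \<Gamma>. is_interval J \<and> g piecewise_C1_differentiable_on J)"

definition contour_image :: "curve list \<Rightarrow> complex set" where
  "contour_image \<Gamma> = (\<Union>(g, J) \<in> set \<Gamma>. g ` J)"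

text \<open>The integrand is the one of \<^const>\<open>has_contour_integral\<close>, with \<open>J\<close> in place of \<open>{0..1}\<close>.\<close>

fun has_curve_integral :: "(complex \<Rightarrow> complex) \<Rightarrow> complex \<Rightarrow> curve \<Rightarrow> bool" where
  "has_curve_integral f I (g, J) \<longleftrightarrow>
     ((\<lambda>t. f (g t) * vector_derivative g (at t within J)) has_integral I) J"

lemma has_curve_integral_valid_path:
  "has_curve_integral f I (g, {0..1}) \<longleftrightarrow> (f has_contour_integral I) g"
  by (simp add: has_contour_integral_def)

definition has_integral_along :: "(complex \<Rightarrow> complex) \<Rightarrow> complex \<Rightarrow> curve list \<Rightarrow> bool" where
  "has_integral_along f I \<Gamma> \<longleftrightarrow>
     (\<exists>c. (\<forall>n < length \<Gamma>. has_curve_integral f (c n) (\<Gamma> ! n)) \<and> I = (\<Sum>n < length \<Gamma>. c n))"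

definition has_matrix_integral_along ::
    "(complex \<Rightarrow> complex^'k^'j) \<Rightarrow> complex^'k^'j \<Rightarrow> curve list \<Rightarrow> bool" where
  "has_matrix_integral_along F I \<Gamma> \<longleftrightarrow>
     (\<forall>i j. has_integral_along (\<lambda>w. F w $ i $ j) (I $ i $ j) \<Gamma>)"

text \<open>
  The value at zeros of the reduced denominator is unconstrained.  As \<open>p\<close> and \<open>q\<close> are coprime,
  these zeros are exactly the poles.
\<close>

definition rational_fun :: "(complex \<Rightarrow> complex) \<Rightarrow> bool" where
  "rational_fun f \<longleftrightarrow>
     (\<exists>p q. q \<noteq> 0 \<and> coprime p q \<and> (\<forall>z. poly q z \<noteq> 0 \<longrightarrow> f z = poly p z / poly q z))"

definition rational_matrix :: "(complex \<Rightarrow> complex^'k^'j) \<Rightarrow> bool" where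
  "rational_matrix W \<longleftrightarrow> (\<forall>i j. rational_fun (\<lambda>z. W z $ i $ j))"

definition matrix_has_pole :: "(complex \<Rightarrow> complex^'k^'j) \<Rightarrow> complex \<Rightarrow> bool" where
  "matrix_has_pole W z \<longleftrightarrow> (\<exists>i j. is_pole (\<lambda>w. W w $ i $ j) z)"

definition diag_matrix :: "complex^'r \<Rightarrow> complex^'r^'r" where
  "diag_matrix d = (\<chi> i j. if i = j then d $ i else 0)"

definition diagonalizable :: "complex^'r^'r \<Rightarrow> bool" where
  "diagonalizable A \<longleftrightarrow>
     (\<exists>(E :: complex^'r^'r) d. invertible E \<and> A = E ** diag_matrix d ** matrix_inv E)"


section \<open>Matrix polynomials and the Christoffel--Darboux kernel\<close>

text \<open>\<open>matrix_polys N\<close> consists of the matrix polynomials of degree at most \<open>N - 1\<close>;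
  \<open>vector_polys N\<close> serves for both \<open>1 \<times> r\<close> and \<open>r \<times> 1\<close> matrix polynomials.\<close>

definition matrix_polys :: "nat \<Rightarrow> (complex \<Rightarrow> complex^'k^'j) set" where
  "matrix_polys N = {P. \<exists>C. P = (\<lambda>z. \<chi> i j. \<Sum>l<N. C l $ i $ j * z ^ l)}"

definition vector_polys :: "nat \<Rightarrow> (complex \<Rightarrow> complex^'r) set" where
  "vector_polys N = {P. \<exists>C. P = (\<lambda>z. \<chi> i. \<Sum>l<N. C l $ i * z ^ l)}"

definition bivariate_matrix_poly :: "nat \<Rightarrow> (complex \<Rightarrow> complex \<Rightarrow> complex^'k^'j) \<Rightarrow> bool" where
  "bivariate_matrix_poly N R \<longleftrightarrow>
     (\<exists>C. \<forall>w z. R w z = (\<chi> i j. \<Sum>k<N. \<Sum>l<N. C k l $ i $ j * w ^ k * z ^ l))"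

definition is_CD_kernel ::
    "curve list \<Rightarrow> (complex \<Rightarrow> complex^'r^'r) \<Rightarrow> nat \<Rightarrow> (complex \<Rightarrow> complex \<Rightarrow> complex^'r^'r) \<Rightarrow> bool" where
  "is_CD_kernel \<Gamma> W N R \<longleftrightarrow>
     bivariate_matrix_poly N R \<and>
     ((\<forall>P :: complex \<Rightarrow> complex^'r^'r. P \<in> matrix_polys N \<longrightarrow>
         (\<forall>z. has_matrix_integral_along (\<lambda>w. P w ** W w ** R w z) (P z) \<Gamma>)) \<or>
      (\<forall>P :: complex \<Rightarrow> complex^'r^'r. P \<in> matrix_polys N \<longrightarrow>
         (\<forall>w. has_matrix_integral_along (\<lambda>z. R w z ** W z ** P z) (P w) \<Gamma>)))"


section \<open>Riemann surfaces over the Riemann sphere\<close>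

text \<open>An atlas is a set of pairs of a chart domain and a chart map.  Connectedness is not required.\<close>

type_synonym 'm atlas = "('m set \<times> ('m \<Rightarrow> complex)) set"

definition riemann_surface :: "'m topology \<Rightarrow> 'm atlas \<Rightarrow> bool" where
  "riemann_surface X A \<longleftrightarrow>
     Hausdorff_space X \<and>
     (\<Union>(U, \<phi>) \<in> A. U) = topspace X \<and>
     (\<forall>(U, \<phi>) \<in> A. openin X U \<and> open (\<phi> ` U) \<and>
        homeomorphic_map (subtopology X U) (top_of_set (\<phi> ` U)) \<phi>) \<and>
     (\<forall>(U, \<phi>) \<in> A. \<forall>(V, \<psi>) \<in> A. (\<psi> \<circ> inv_into U \<phi>) holomorphic_on \<phi> ` (U \<inter> V))"

text \<open>The Riemann sphere; \<^const>\<open>None\<close> is the point at infinity.\<close>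

definition sphere_top :: "complex option topology" where
  "sphere_top = Alexandroff_compactification euclidean"

definition sphere_atlas :: "complex option atlas" where
  "sphere_atlas =
     {(range Some, the),
      (- {Some 0}, \<lambda>q. case q of None \<Rightarrow> 0 | Some z \<Rightarrow> inverse z)}"

definition holomorphic_map ::
    "'m topology \<Rightarrow> 'm atlas \<Rightarrow> 'n topology \<Rightarrow> 'n atlas \<Rightarrow> ('m \<Rightarrow> 'n) \<Rightarrow> bool" where
  "holomorphic_map X A Y B f \<longleftrightarrow>
     continuous_map X Y f \<and>
     (\<forall>(U, \<phi>) \<in> A. \<forall>(V, \<psi>) \<in> B. (\<psi> \<circ> f \<circ> inv_into U \<phi>) holomorphic_on \<phi> ` (U \<inter> f -` V))"

text \<open>
  A meromorphic function is represented by a total function which at a point that is not a pole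
  takes the value of the analytic continuation, and which is 0 at poles.
\<close>

definition meromorphic_fun :: "'m atlas \<Rightarrow> ('m \<Rightarrow> complex) \<Rightarrow> bool" where
  "meromorphic_fun A f \<longleftrightarrow> (\<forall>(U, \<phi>) \<in> A. (f \<circ> inv_into U \<phi>) nicely_meromorphic_on \<phi> ` U)"

definition pole_at :: "'m atlas \<Rightarrow> ('m \<Rightarrow> complex) \<Rightarrow> 'm \<Rightarrow> bool" where
  "pole_at A f p \<longleftrightarrow> (\<exists>(U, \<phi>) \<in> A. p \<in> U \<and> is_pole (f \<circ> inv_into U \<phi>) (\<phi> p))"

definition vector_poles :: "'m topology \<Rightarrow> 'm atlas \<Rightarrow> ('m \<Rightarrow> complex^'r) \<Rightarrow> 'm set" where
  "vector_poles X A f = {p \<in> topspace X. \<exists>i. pole_at A (\<lambda>q. f q $ i) p}"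

text \<open>
  A holomorphic map from a compact surface to the sphere is a branched covering iff it is
  nonconstant on every component, that is, iff all its fibres are finite; its number of sheets is
  then the number of points in a generic fibre.
\<close>

definition sheeted_covering :: "nat \<Rightarrow> 'm topology \<Rightarrow> 'm atlas \<Rightarrow> ('m \<Rightarrow> complex option) \<Rightarrow> bool" where
  "sheeted_covering r X A \<pi> \<longleftrightarrow>
     riemann_surface X A \<and> compact_space X \<and>
     holomorphic_map X A sphere_top sphere_atlas \<pi> \<and>
     (\<forall>q. finite {p \<in> topspace X. \<pi> p = q}) \<and>
     (\<exists>F. finite F \<and> (\<forall>q. q \<notin> F \<longrightarrow> card {p \<in> topspace X. \<pi> p = q} = r))"

text \<open>
  \<open>s k z\<close> is the point over \<open>z\<close> on the \<open>k\<close>-th sheet.  Off a system \<open>C\<close> of branch cuts, the sheets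
  are continuous copies of the plane; they exhaust every fibre, so that over all but finitely many
  \<open>z\<close> the points \<open>s k z\<close> are pairwise distinct.
\<close>

definition sheet_numbering ::
    "'m topology \<Rightarrow> ('m \<Rightarrow> complex option) \<Rightarrow> ('r \<Rightarrow> complex \<Rightarrow> 'm) \<Rightarrow> bool" where
  "sheet_numbering X \<pi> s \<longleftrightarrow>
     (\<forall>z. range (\<lambda>k. s k z) = {p \<in> topspace X. \<pi> p = Some z}) \<and>
     (\<exists>C. closed C \<and> interior C = {} \<and> (\<forall>k. continuous_map (top_of_set (- C)) X (s k)))"

definition finite_points :: "'m topology \<Rightarrow> ('m \<Rightarrow> complex option) \<Rightarrow> 'm set" where
  "finite_points X \<pi> = {p \<in> topspace X. \<pi> p \<noteq> None}"

definition spectral_data ::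
    "(complex \<Rightarrow> complex^'r^'r) \<Rightarrow> ('r \<Rightarrow> complex \<Rightarrow> 'm) \<Rightarrow>
     (complex \<Rightarrow> complex^'r^'r) \<Rightarrow> (complex \<Rightarrow> complex^'r) \<Rightarrow>
     ('m \<Rightarrow> complex) \<Rightarrow> ('m \<Rightarrow> complex^'r) \<Rightarrow> ('m \<Rightarrow> complex^'r) \<Rightarrow> bool" where
  "spectral_data W s E d ev e eh \<longleftrightarrow>
     (\<exists>F. finite F \<and>
       (\<forall>z. z \<notin> F \<longrightarrow>
          invertible (E z) \<and> W z = E z ** diag_matrix (d z) ** matrix_inv (E z) \<and>
          (\<forall>k. ev (s k z) = d z $ k \<and>
               e (s k z) = E z *v axis k 1 \<and>
               eh (s k z) = axis k 1 v* matrix_inv (E z))))"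

text \<open>
  The integral over the lift of \<open>\<Gamma>\<close> to all sheets.  The sum over the sheets is taken under the
  integral sign: at points of \<open>\<Gamma>\<close> over which the integrand has poles (for instance branch points)
  the contributions of single sheets may diverge although their sum is regular.
\<close>

definition has_integral_on_sheets ::
    "('m \<Rightarrow> complex) \<Rightarrow> complex \<Rightarrow> ('r::finite \<Rightarrow> complex \<Rightarrow> 'm) \<Rightarrow> curve list \<Rightarrow> bool" where
  "has_integral_on_sheets f I s \<Gamma> \<longleftrightarrow> has_integral_along (\<lambda>w. \<Sum>k\<in>UNIV. f (s k w)) I \<Gamma>"

lemma has_integral_on_sheets_sum:
  fixes s :: "'r::finite \<Rightarrow> complex \<Rightarrow> 'm"
  assumes "\<And>k. has_integral_along (\<lambda>w. f (s k w)) (I k) \<Gamma>"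
  shows "has_integral_on_sheets f (\<Sum>k\<in>UNIV. I k) s \<Gamma>"
proof -
  have "\<forall>k. \<exists>c. (\<forall>n < length \<Gamma>. has_curve_integral (\<lambda>w. f (s k w)) (c n) (\<Gamma> ! n)) \<and>
      I k = (\<Sum>n < length \<Gamma>. c n)"
    using assms unfolding has_integral_along_def by (rule allI)
  from choice[OF this] obtain c where
    c: "\<forall>k. (\<forall>n < length \<Gamma>. has_curve_integral (\<lambda>w. f (s k w)) (c k n) (\<Gamma> ! n)) \<and>
      I k = (\<Sum>n < length \<Gamma>. c k n)" ..
  have "has_curve_integral (\<lambda>w. \<Sum>k\<in>UNIV. f (s k w)) (\<Sum>k\<in>UNIV. c k n) (\<Gamma> ! n)"
    if "n < length \<Gamma>" for n
  proof -
    obtain g J where gJ: "\<Gamma> ! n = (g, J)"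
      by (cases "\<Gamma> ! n")
    have "((\<lambda>t. f (s k (g t)) * vector_derivative g (at t within J)) has_integral c k n) J" for k
      using c[rule_format, THEN conjunct1, rule_format, OF that, of k]
      by (simp only: gJ has_curve_integral.simps)
    then show ?thesis
      unfolding gJ has_curve_integral.simps sum_distrib_right
      by (intro has_integral_sum finite)
  qed
  moreover have "(\<Sum>k\<in>UNIV. I k) = (\<Sum>n < length \<Gamma>. \<Sum>k\<in>UNIV. c k n)"
    using c by (simp add: sum.swap[of _ UNIV])
  ultimately show ?thesis
    unfolding has_integral_on_sheets_def has_integral_along_def
    by (intro exI[of _ "\<lambda>n. \<Sum>k\<in>UNIV. c k n"] conjI allI impI)
qed


section \<open>The spaces of scalar functions\<close>

text \<open>Functions with domain \<open>D\<close> are represented as total functions that vanish outside \<open>D\<close>.\<close>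

definition on_domain :: "'m set \<Rightarrow> ('m \<Rightarrow> complex) \<Rightarrow> 'm \<Rightarrow> complex" where
  "on_domain D f = (\<lambda>p. if p \<in> D then f p else 0)"

definition L_space ::
    "nat \<Rightarrow> 'm set \<Rightarrow> ('m \<Rightarrow> complex option) \<Rightarrow> ('m \<Rightarrow> complex^'r) \<Rightarrow> ('m \<Rightarrow> complex) set" where
  "L_space N D \<pi> e = {on_domain D (\<lambda>p. scalar_product (P (the (\<pi> p))) (e p)) | P. P \<in> vector_polys N}"

definition Lhat_space ::
    "nat \<Rightarrow> 'm set \<Rightarrow> ('m \<Rightarrow> complex option) \<Rightarrow> ('m \<Rightarrow> complex^'r) \<Rightarrow> ('m \<Rightarrow> complex) set" where
  "Lhat_space N D \<pi> eh = {on_domain D (\<lambda>p. scalar_product (eh p) (P (the (\<pi> p)))) | P. P \<in> vector_polys N}"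

definition fun_scale :: "complex \<Rightarrow> ('m \<Rightarrow> complex) \<Rightarrow> 'm \<Rightarrow> complex" where
  "fun_scale c f = (\<lambda>p. c * f p)"

lemma vector_space_fun_scale: "vector_space fun_scale"
  by unfold_locales
    (simp_all add: fun_scale_def plus_fun_def distrib_left distrib_right mult.assoc)

abbreviation complex_dim :: "('m \<Rightarrow> complex) set \<Rightarrow> nat" where
  "complex_dim \<equiv> vector_space.dim fun_scale"

end

theory Submission
  imports Defs
begin

text \<open>
  Write \<open>\<bullet>\<close> for the bilinear product \<^const>\<open>scalar_product\<close>, fix a generic \<open>w\<close>, and let \<open>s k w\<close> be
  the points over it.  The columns \<open>e (s k w)\<close> of \<open>E w\<close>, the rows
  \<open>eh (s k w)\<close> of its inverse and the eigenvalues \<open>ev (s k w)\<close> recompose the weight: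
  \<open>\<Sum>k. (u \<bullet> e (s k w)) * ev (s k w) * (eh (s k w) \<bullet> v) = u \<bullet> (W w *v v)\<close>, which is lemma
  \<open>spectral_sum\<close>.  Hence summing the integrand of either scalar reproducing property over the sheets
  gives the integrand of a reproducing property of the matrix kernel, applied to a fixed vector, for
  all \<open>w\<close> outside a finite set \<open>B\<close>: the finitely many exceptional points of the diagonalisation
  and the projections of the poles of \<open>e\<close> and \<open>eh\<close>.  Three points need an argument.

  \<^item> The set \<open>B\<close> is finite because \<open>X\<close> is compact and poles of a meromorphic function are isolated
    (\<open>finite_vector_poles\<close>), and integrals along a contour do not see finite sets
    (\<open>has_integral_along_spike\<close>), although a curve may rest at a point of \<open>B\<close> for a whole
    interval of parameters, or return to it infinitely often.

  \<^item> The matrix kernel is only known to reproduce on one side, whereas both sides are used.  Suppose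
    that it reproduces rows, that is, \<open>\<integral> P(w) W(w) R(w,z) dw = P(z)\<close>.  Then the columns of
    \<open>R(\<cdot>, z\<^sub>i)\<close>, for \<open>N\<close> distinct nodes \<open>z\<^sub>i\<close>, are linearly independent, since integrating them
    against Lagrange polynomials isolates each coefficient; by counting they span all column
    polynomials of degree below \<open>N\<close>.  For a column polynomial \<open>R(\<cdot>, z\<^sub>i) v\<close> the reproduction of
    columns is the reproduction of the row \<open>u R(w, \<cdot>)\<close>, evaluated at \<open>z\<^sub>i\<close> and applied to \<open>v\<close>
    (\<open>reproduces_rows_imp_columns\<close>).  Transposition gives the converse.  All integrals
    used are combinations of those that the hypothesis supplies; the moments of \<open>W\<close> are never taken
    separately, as their convergence along unbounded curves is not given.

  \<^item> The dimension is \<open>r * N\<close> because \<open>P(z) \<bullet> e\<close> vanishes on all sheets over a generic \<open>z\<close>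
    only if \<open>P(z) = 0\<close>, and a polynomial with infinitely many zeros vanishes (\<open>dim_L_space\<close>).
\<close>


section \<open>Integrals along contours\<close>

lemma countable_isolated_points:
  fixes A :: "real set"
  shows "countable {x \<in> A. \<not> x islimpt A}"
proof -
  have "open {x. \<not> x islimpt A}"
    using closed_limpts[of A] by (simp add: closed_def Collect_neg_eq)
  moreover have "A sparse_in {x. \<not> x islimpt A}"
    using calculation by (auto simp: sparse_in_open)
  ultimately have "countable ({x. \<not> x islimpt A} \<inter> A)"
    by (intro sparse_imp_countable)
  then show ?thesis
    by (simp add: Int_def conj_commute)
qed

lemma countable_imp_negligible:
  fixes S :: "'a::euclidean_space set"
  assumes "countable S"
  shows "negligible S"
  using negligible_countable_Union[of "(\<lambda>x. {x}) ` S"] assms by auto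

text \<open>
  A curve that returns to a value \<open>p\<close> at parameters accumulating at \<open>t\<close> has velocity 0 at \<open>t\<close>.
  So the parameters at which it is at \<open>p\<close> with nonzero velocity are isolated in their fibre, apart
  from the finitely many break points, and there are only countably many of them.  The parameters
  at which it rests in \<open>p\<close> may have positive measure, but they do not contribute to an integral.
\<close>

lemma negligible_moving_on_fibre:
  fixes g :: "real \<Rightarrow> complex"
  assumes "g piecewise_C1_differentiable_on J" and "finite B"
  shows "negligible {t \<in> J. g t \<in> B \<and> vector_derivative g (at t within J) \<noteq> 0}"
proof -
  obtain S where S: "finite S" "g C1_differentiable_on (J - S)"
    using assms(1) by (auto simp: piecewise_C1_differentiable_on_def)
  define A where "A p = {t \<in> J. g t = p}" for p
  have "t \<in> S \<or> \<not> t islimpt A (g t)"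
    if t: "t \<in> J" "vector_derivative g (at t within J) \<noteq> 0" for t
  proof (rule ccontr)
    assume "\<not> (t \<in> S \<or> \<not> t islimpt A (g t))"
    then have lim: "t islimpt A (g t)" and "t \<in> J - S"
      using t by auto
    then obtain v where v: "(g has_vector_derivative v) (at t)"
      using S(2) unfolding C1_differentiable_on_def by blast
    have A: "at t within A (g t) \<noteq> bot" "at t within J \<noteq> bot"
      using lim islimpt_subset[OF lim, of J] by (auto simp: trivial_limit_within A_def)
    have "((\<lambda>_. g t) has_vector_derivative 0) (at t within A (g t))"
      by simp
    then have "(g has_vector_derivative 0) (at t within A (g t))"
      by (rule has_vector_derivative_transform[rotated 2]) (use t in \<open>auto simp: A_def\<close>)
    then have "v = 0"
      using A(1) v vector_derivative_unique_within has_vector_derivative_at_within by blast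
    moreover have "vector_derivative g (at t within J) = v"
      using A(2) v has_vector_derivative_at_within vector_derivative_within by blast
    ultimately show False
      using t by simp
  qed
  then have "{t \<in> J. g t \<in> B \<and> vector_derivative g (at t within J) \<noteq> 0}
      \<subseteq> S \<union> (\<Union>p\<in>B. {t \<in> A p. \<not> t islimpt A p})"
    by (fastforce simp: A_def)
  moreover have "countable (S \<union> (\<Union>p\<in>B. {t \<in> A p. \<not> t islimpt A p}))"
    using S(1) assms(2) by (intro countable_Un countable_UN countable_isolated_points countable_finite)
  ultimately show ?thesis
    using negligible_subset countable_imp_negligible by blast
qed

text \<open>
  Where the integrands differ, the velocity of the curve vanishes, up to a negligible set.
\<close>

lemma has_integral_along_spike:
  assumes "piecewise_smooth_contour \<Gamma>" and "finite B"
    and eq: "\<And>w. w \<notin> B \<Longrightarrow> f w = g w"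
    and "has_integral_along g I \<Gamma>"
  shows "has_integral_along f I \<Gamma>"
proof -
  obtain c where c: "\<And>n. n < length \<Gamma> \<Longrightarrow> has_curve_integral g (c n) (\<Gamma> ! n)"
      and I: "I = (\<Sum>n < length \<Gamma>. c n)"
    using assms(4) unfolding has_integral_along_def by blast
  have "has_curve_integral f (c n) (\<Gamma> ! n)" if n: "n < length \<Gamma>" for n
  proof -
    obtain h J where hJ: "\<Gamma> ! n = (h, J)"
      by (cases "\<Gamma> ! n")
    have "(h, J) \<in> set \<Gamma>"
      using n hJ by (metis nth_mem)
    then have "h piecewise_C1_differentiable_on J"
      using assms(1) by (auto simp: piecewise_smooth_contour_def)
    then have neg: "negligible {t \<in> J. h t \<in> B \<and> vector_derivative h (at t within J) \<noteq> 0}"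
      using assms(2) by (rule negligible_moving_on_fibre)
    have "((\<lambda>t. g (h t) * vector_derivative h (at t within J)) has_integral c n) J"
      using c[OF n] by (simp add: hJ)
    then have "((\<lambda>t. f (h t) * vector_derivative h (at t within J)) has_integral c n) J"
      by (rule has_integral_spike[OF neg, rotated]) (auto simp: eq)
    then show ?thesis
      by (simp add: hJ)
  qed
  with I show ?thesis
    unfolding has_integral_along_def by blast
qed

lemma has_integral_along_sum:
  assumes "finite S" and "\<And>i. i \<in> S \<Longrightarrow> has_integral_along (f i) (I i) \<Gamma>"
  shows "has_integral_along (\<lambda>w. \<Sum>i\<in>S. a i * f i w) (\<Sum>i\<in>S. a i * I i) \<Gamma>"
proof -
  obtain c where c: "\<And>i n. i \<in> S \<Longrightarrow> n < length \<Gamma> \<Longrightarrow> has_curve_integral (f i) (c i n) (\<Gamma> ! n)"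
      "\<And>i. i \<in> S \<Longrightarrow> I i = (\<Sum>n < length \<Gamma>. c i n)"
    using assms(2) unfolding has_integral_along_def by metis
  have "has_curve_integral (\<lambda>w. \<Sum>i\<in>S. a i * f i w) (\<Sum>i\<in>S. a i * c i n) (\<Gamma> ! n)"
    if n: "n < length \<Gamma>" for n
  proof -
    obtain h J where hJ: "\<Gamma> ! n = (h, J)"
      by (cases "\<Gamma> ! n")
    have "((\<lambda>t. \<Sum>i\<in>S. a i * (f i (h t) * vector_derivative h (at t within J)))
        has_integral (\<Sum>i\<in>S. a i * c i n)) J"
      using c(1)[OF _ n] by (intro has_integral_sum assms(1) has_integral_mult_right) (simp add: hJ)
    then show ?thesis
      by (simp add: hJ sum_distrib_right mult.assoc)
  qed
  moreover have "(\<Sum>i\<in>S. a i * I i) = (\<Sum>n < length \<Gamma>. \<Sum>i\<in>S. a i * c i n)"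
    by (simp add: c(2) sum_distrib_left sum.swap[of _ S])
  ultimately show ?thesis
    unfolding has_integral_along_def by (intro exI[of _ "\<lambda>n. \<Sum>i\<in>S. a i * c i n"]) simp
qed

lemma has_integral_along_unique:
  assumes "has_integral_along f I \<Gamma>" "has_integral_along f I' \<Gamma>"
  shows "I = I'"
proof -
  obtain c c' where c: "\<And>n. n < length \<Gamma> \<Longrightarrow> has_curve_integral f (c n) (\<Gamma> ! n)"
      "I = (\<Sum>n < length \<Gamma>. c n)"
    and c': "\<And>n. n < length \<Gamma> \<Longrightarrow> has_curve_integral f (c' n) (\<Gamma> ! n)"
      "I' = (\<Sum>n < length \<Gamma>. c' n)"
    using assms unfolding has_integral_along_def by metis
  have "c n = c' n" if "n < length \<Gamma>" for n
    using c(1)[OF that] c'(1)[OF that] has_integral_unique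
    by (cases "\<Gamma> ! n") (auto dest: has_integral_unique)
  then show ?thesis
    by (simp add: c(2) c'(2))
qed

section \<open>Finite families in spaces of scalar functions\<close>

interpretation function_space: vector_space fun_scale
  by (rule vector_space_fun_scale)

lemma sum_fun_scale_apply: "(\<Sum>i\<in>I. fun_scale (a i) (b i)) x = (\<Sum>i\<in>I. a i * b i x)"
  by (induction I rule: infinite_finite_induct) (simp_all add: fun_scale_def)

text \<open>
  Families rather than sets, so that coefficients can be indexed by \<open>'r \<times> nat\<close> and injectivity
  is a consequence instead of a hypothesis.
\<close>

definition independent_family :: "'i set \<Rightarrow> ('i \<Rightarrow> 'm \<Rightarrow> complex) \<Rightarrow> bool" where
  "independent_family I b \<longleftrightarrow>
     (\<forall>a. (\<forall>x. (\<Sum>i\<in>I. a i * b i x) = 0) \<longrightarrow> (\<forall>i\<in>I. a i = 0))"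

lemma independent_family_inj_on:
  assumes "finite I" and b: "independent_family I b"
  shows "inj_on b I"
proof (rule inj_onI, rule ccontr)
  fix i j assume ij: "i \<in> I" "j \<in> I" "b i = b j" "i \<noteq> j"
  define a where "a k = (if k = i then 1 else 0) - (if k = j then 1 else (0::complex))" for k
  have "(\<Sum>k\<in>I. a k * b k x) = 0" for x
    using ij assms(1) by (simp add: a_def left_diff_distrib sum_subtractf if_distrib[of "\<lambda>c. c * _"] cong: if_cong)
  then have "a i = 0"
    using b ij(1) unfolding independent_family_def by blast
  with ij(4) show False
    by (simp add: a_def)
qed

lemma independent_family_imp_independent:
  assumes "finite I" and b: "independent_family I b"
  shows "function_space.independent (b ` I)"
proof (rule function_space.independent_if_scalars_zero)
  show "finite (b ` I)"
    using assms(1) by simp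
  fix c f assume 0: "(\<Sum>x\<in>b ` I. fun_scale (c x) x) = 0" and "f \<in> b ` I"
  have "(\<Sum>i\<in>I. fun_scale (c (b i)) (b i)) = 0"
    using 0 by (simp add: sum.reindex[OF independent_family_inj_on[OF assms]])
  then have "(\<Sum>i\<in>I. c (b i) * b i x) = 0" for x
    by (metis sum_fun_scale_apply zero_fun_apply)
  then have "\<forall>i\<in>I. c (b i) = 0"
    using b[unfolded independent_family_def, rule_format, of "\<lambda>i. c (b i)"] by blast
  then show "c f = 0"
    using \<open>f \<in> b ` I\<close> by blast
qed

lemma span_family:
  assumes "finite I"
  shows "f \<in> function_space.span (b ` I) \<longleftrightarrow> (\<exists>a. f = (\<lambda>x. \<Sum>i\<in>I. a i * b i x))"
proof
  assume "f \<in> function_space.span (b ` I)"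
  then show "\<exists>a. f = (\<lambda>x. \<Sum>i\<in>I. a i * b i x)"
  proof (induction rule: function_space.span_induct_alt)
    case base
    show ?case by (rule exI[of _ "\<lambda>_. 0"]) (simp add: fun_eq_iff)
  next
    case (step c g f)
    then obtain i a where i: "i \<in> I" "g = b i" and a: "f = (\<lambda>x. \<Sum>i\<in>I. a i * b i x)"
      by auto
    show ?case
      using assms i
      by (intro exI[of _ "\<lambda>k. (if k = i then c else 0) + a k"])
        (simp add: fun_eq_iff fun_scale_def a distrib_right sum.distrib if_distrib[of "\<lambda>c. c * _"]
          cong: if_cong)
  qed
next
  assume "\<exists>a. f = (\<lambda>x. \<Sum>i\<in>I. a i * b i x)"
  then obtain a where "f = (\<lambda>x. \<Sum>i\<in>I. a i * b i x)" ..
  then have f: "f = (\<Sum>i\<in>I. fun_scale (a i) (b i))"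
    by (simp add: fun_eq_iff sum_fun_scale_apply)
  show "f \<in> function_space.span (b ` I)"
    unfolding f
    by (intro function_space.span_sum function_space.span_scale function_space.span_base imageI)
qed

text \<open>
  The exchange lemma: an element outside the span would enlarge the family to an independent set
  with more than \<open>card T\<close> elements.
\<close>

lemma independent_family_spans:
  assumes "finite I" "finite T" "card T \<le> card I" "independent_family I b"
    and "b ` I \<subseteq> function_space.span T"
  shows "function_space.span T \<subseteq> function_space.span (b ` I)"
proof
  fix f assume f: "f \<in> function_space.span T"
  have ind: "function_space.independent (b ` I)"
    using assms by (intro independent_family_imp_independent)
  show "f \<in> function_space.span (b ` I)"
  proof (rule ccontr)
    assume nf: "f \<notin> function_space.span (b ` I)"
    have "card (insert f (b ` I)) \<le> card T"
      using function_space.independent_span_bound[OF assms(2) function_space.independent_insertI[OF nf ind]]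
        assms(5) f by simp
    moreover have "f \<notin> b ` I"
      using nf function_space.span_base[of f "b ` I"] by auto
    ultimately show False
      using assms(1,3) card_image[OF independent_family_inj_on[OF assms(1,4)]] by simp
  qed
qed

section \<open>The dimension of the spaces \<open>P(z) e\<close>\<close>

lemma L_space_eq_span:
  fixes e :: "'m \<Rightarrow> complex^'r"
  shows "L_space N D \<pi> e = function_space.span
     ((\<lambda>(k, l). on_domain D (\<lambda>p. the (\<pi> p) ^ l * e p $ k)) ` (UNIV \<times> {..<N}))" (is "_ = ?S")
proof -
  have eq: "on_domain D (\<lambda>p. scalar_product (\<chi> i. \<Sum>l<N. C l $ i * the (\<pi> p) ^ l) (e p)) =
      (\<lambda>p. \<Sum>i\<in>UNIV \<times> {..<N}. (case i of (k, l) \<Rightarrow> C l $ k) *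
         (case i of (k, l) \<Rightarrow> on_domain D (\<lambda>p. the (\<pi> p) ^ l * e p $ k)) p)" for C
    by (auto simp: on_domain_def scalar_product_def sum.cartesian_product' sum_distrib_right
        fun_eq_iff mult.assoc case_prod_beta)
  have "f \<in> L_space N D \<pi> e \<longleftrightarrow> f \<in> ?S" for f
  proof
    assume "f \<in> L_space N D \<pi> e"
    then obtain C where
      "f = on_domain D (\<lambda>p. scalar_product (\<chi> i. \<Sum>l<N. C l $ i * the (\<pi> p) ^ l) (e p))"
      unfolding L_space_def vector_polys_def by blast
    then show "f \<in> ?S"
      unfolding eq by (subst span_family) auto
  next
    assume "f \<in> ?S"
    then obtain a where f: "f = (\<lambda>p. \<Sum>i\<in>UNIV \<times> {..<N}. a i *
         (case i of (k, l) \<Rightarrow> on_domain D (\<lambda>p. the (\<pi> p) ^ l * e p $ k)) p)"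
      by (subst (asm) span_family) auto
    have "f = on_domain D (\<lambda>p. scalar_product (\<chi> i. \<Sum>l<N. (\<chi> k. a (k, l)) $ i * the (\<pi> p) ^ l) (e p))"
      unfolding f eq by (auto simp: fun_eq_iff intro!: sum.cong)
    then show "f \<in> L_space N D \<pi> e"
      unfolding L_space_def vector_polys_def
      by (intro CollectI exI[of _ "\<lambda>z. \<chi> i. \<Sum>l<N. (\<chi> k. a (k, l)) $ i * z ^ l"])
         (auto intro!: exI[of _ "\<lambda>l. \<chi> k. a (k, l)"])
  qed
  then show ?thesis by blast
qed

lemma power_sum_infinite_zeros:
  fixes c :: "nat \<Rightarrow> complex"
  assumes "infinite Z" and 0: "\<And>z. z \<in> Z \<Longrightarrow> (\<Sum>l<N. c l * z ^ l) = 0" and "l < N"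
  shows "c l = 0"
proof -
  define p where "p = (\<Sum>l<N. monom (c l) l)"
  have "poly p z = (\<Sum>l<N. c l * z ^ l)" for z
    by (simp add: p_def poly_sum poly_monom)
  then have "Z \<subseteq> {z. poly p z = 0}"
    using 0 by auto
  then have "p = 0"
    using assms(1) poly_roots_finite finite_subset by blast
  moreover have "coeff p l = c l"
    using assms(3) by (simp add: p_def coeff_sum)
  ultimately show ?thesis by simp
qed

text \<open>
  A relation between the functions \<open>z\<^sup>l e\<^sub>k\<close> is a polynomial vector that is annihilated by all
  values of \<open>e\<close> over each \<open>z\<close>.  Where these values separate vectors, it vanishes, and infinitely
  many such \<open>z\<close> force all its coefficients to be 0.
\<close>

lemma L_basis_independent:
  fixes e :: "'m \<Rightarrow> complex^'r"
  assumes "infinite Z"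
    and sep: "\<And>z v. z \<in> Z \<Longrightarrow> (\<And>p. p \<in> D \<Longrightarrow> \<pi> p = Some z \<Longrightarrow> scalar_product v (e p) = 0) \<Longrightarrow> v = 0"
  shows "independent_family (UNIV \<times> {..<N})
    (\<lambda>(k, l). on_domain D (\<lambda>p. the (\<pi> p) ^ l * e p $ k))"
  unfolding independent_family_def
proof (intro allI impI)
  fix a
  assume 0: "\<forall>p. (\<Sum>i\<in>UNIV \<times> {..<N}. a i *
    (case i of (k, l) \<Rightarrow> on_domain D (\<lambda>p. the (\<pi> p) ^ l * e p $ k)) p) = 0"
  have "(\<chi> k. \<Sum>l<N. a (k, l) * z ^ l) = (0 :: complex^'r)" if "z \<in> Z" for z
  proof (rule sep[OF that])
    fix p assume "p \<in> D" "\<pi> p = Some z"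
    then show "scalar_product (\<chi> k. \<Sum>l<N. a (k, l) * z ^ l) (e p) = 0"
      using 0[rule_format, of p]
      by (simp add: on_domain_def scalar_product_def sum.cartesian_product' sum_distrib_right
        mult.assoc)
  qed
  then have "(\<Sum>l<N. a (k, l) * z ^ l) = 0" if "z \<in> Z" for z k
    using that by (simp add: vec_eq_iff)
  then have "a (k, l) = 0" if "l < N" for k l
    using power_sum_infinite_zeros[OF assms(1), where c = "\<lambda>l. a (k, l)"] that by blast
  then show "\<forall>i\<in>UNIV \<times> {..<N}. a i = 0"
    by auto
qed

lemma dim_L_space:
  fixes e :: "'m \<Rightarrow> complex^'r"
  assumes "infinite Z"
    and sep: "\<And>z v. z \<in> Z \<Longrightarrow> (\<And>p. p \<in> D \<Longrightarrow> \<pi> p = Some z \<Longrightarrow> scalar_product v (e p) = 0) \<Longrightarrow> v = 0"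
  shows "complex_dim (L_space N D \<pi> e) = CARD('r) * N"
proof -
  have ind: "independent_family ((UNIV :: 'r set) \<times> {..<N})
      (\<lambda>(k, l). on_domain D (\<lambda>p. the (\<pi> p) ^ l * e p $ k))"
    using assms by (rule L_basis_independent)
  have "function_space.independent ((\<lambda>(k, l). on_domain D (\<lambda>p. the (\<pi> p) ^ l * e p $ k))
      ` ((UNIV :: 'r set) \<times> {..<N}))"
    by (rule independent_family_imp_independent[OF _ ind]) simp
  then show ?thesis
    unfolding L_space_eq_span
    by (subst function_space.dim_span_eq_card_independent)
      (simp_all add: card_image[OF independent_family_inj_on[OF _ ind]] card_cartesian_product)
qed

section \<open>The two reproducing properties of the Christoffel--Darboux kernel\<close>

lemma scalar_product_commute:
  fixes u v :: "complex^'r"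
  shows "scalar_product u v = scalar_product v u"
  by (simp add: scalar_product_def mult.commute)

lemma scalar_product_axis [simp]:
  fixes u :: "complex^'r"
  shows "scalar_product u (axis k 1) = u $ k"
  by (simp add: scalar_product_def axis_def if_distrib cong: if_cong)

lemma scalar_product_axis_left [simp]:
  fixes u :: "complex^'r"
  shows "scalar_product (axis k 1) u = u $ k"
  by (simp add: scalar_product_commute[of "axis k 1"])

lemma matrix_vector_axis:
  fixes M :: "complex^'r^'r"
  shows "(M *v axis j 1) $ i = M $ i $ j"
  by (simp add: matrix_vector_mult_def axis_def if_distrib cong: if_cong)

lemma scalar_product_matrix_vector:
  fixes u v :: "complex^'r"
  shows "scalar_product u (M *v v) = scalar_product (u v* M) v"
proof -
  have "scalar_product u (M *v v) = (\<Sum>i\<in>UNIV. \<Sum>j\<in>UNIV. u $ i * (M $ i $ j * v $ j))"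
    by (simp add: scalar_product_def matrix_vector_mult_def sum_distrib_left)
  also have "\<dots> = (\<Sum>j\<in>UNIV. \<Sum>i\<in>UNIV. u $ i * (M $ i $ j * v $ j))"
    by (rule sum.swap)
  finally show ?thesis
    by (simp add: scalar_product_def vector_matrix_mult_def sum_distrib_left sum_distrib_right mult_ac)
qed

lemma scalar_product_sum_right:
  fixes u :: "complex^'r"
  shows "scalar_product u (\<chi> k. \<Sum>i\<in>S. a i * v i $ k) = (\<Sum>i\<in>S. a i * scalar_product u (v i))"
  by (simp add: scalar_product_def sum_distrib_left sum.swap[of _ S] mult.left_commute)

lemma vector_polysI:
  fixes P :: "complex \<Rightarrow> complex^'r"
  assumes "\<And>z i. P z $ i = (\<Sum>l<N. c i l * z ^ l)"
  shows "P \<in> vector_polys N"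
  unfolding vector_polys_def using assms
  by (intro CollectI exI[of _ "\<lambda>l. \<chi> i. c i l"]) (simp add: fun_eq_iff vec_eq_iff)

lemma vector_polys_poly:
  fixes u :: "complex^'r"
  assumes "degree p < N"
  shows "(\<lambda>z. \<chi> i. u $ i * poly p z) \<in> vector_polys N"
proof (rule vector_polysI)
  fix z i
  have "poly p z = (\<Sum>l<N. coeff p l * z ^ l)"
    unfolding poly_altdef using assms
    by (intro sum.mono_neutral_left) (auto simp: coeff_eq_0)
  then show "(\<chi> i. u $ i * poly p z) $ i = (\<Sum>l<N. (u $ i * coeff p l) * z ^ l)"
    by (simp add: sum_distrib_left mult.assoc)
qed

lemma bivariate_column_poly:
  fixes R :: "complex \<Rightarrow> complex \<Rightarrow> complex^'r^'r"
  assumes "bivariate_matrix_poly N R"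
  shows "(\<lambda>w. R w z *v v) \<in> vector_polys N"
proof -
  obtain C where C: "\<And>w z. R w z = (\<chi> i j. \<Sum>k<N. \<Sum>l<N. C k l $ i $ j * w ^ k * z ^ l)"
    using assms unfolding bivariate_matrix_poly_def by blast
  show ?thesis
  proof (rule vector_polysI)
    fix w i
    have "(R w z *v v) $ i = (\<Sum>j\<in>UNIV. \<Sum>k<N. (\<Sum>l<N. C k l $ i $ j * z ^ l * v $ j) * w ^ k)"
      unfolding C by (simp add: matrix_vector_mult_def sum_distrib_right sum_distrib_left mult_ac)
    also have "\<dots> = (\<Sum>k<N. \<Sum>j\<in>UNIV. (\<Sum>l<N. C k l $ i $ j * z ^ l * v $ j) * w ^ k)"
      by (rule sum.swap)
    finally show "(R w z *v v) $ i = (\<Sum>k<N. (\<Sum>j\<in>UNIV. \<Sum>l<N. C k l $ i $ j * z ^ l * v $ j) * w ^ k)"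
      by (simp add: sum_distrib_right)
  qed
qed

text \<open>
  Transposing the values and swapping the variables turns a kernel for \<open>W\<close> into one for
  \<open>transpose W\<close> and exchanges the two reproducing properties.
\<close>

definition transposed_kernel ::
    "(complex \<Rightarrow> complex \<Rightarrow> complex^'r^'r) \<Rightarrow> complex \<Rightarrow> complex \<Rightarrow> complex^'r^'r" where
  "transposed_kernel R w z = transpose (R z w)"

lemma bivariate_transposed:
  assumes "bivariate_matrix_poly N R"
  shows "bivariate_matrix_poly N (transposed_kernel R)"
proof -
  obtain C where C: "\<And>w z. R w z = (\<chi> i j. \<Sum>k<N. \<Sum>l<N. C k l $ i $ j * w ^ k * z ^ l)"
    using assms unfolding bivariate_matrix_poly_def by blast
  have "transposed_kernel R w z =
      (\<chi> i j. \<Sum>k<N. \<Sum>l<N. transpose (C l k) $ i $ j * w ^ k * z ^ l)" for w z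
    unfolding transposed_kernel_def transpose_def C
    by (simp add: vec_eq_iff) (intro allI, subst sum.swap, simp add: mult_ac)
  then show ?thesis
    unfolding bivariate_matrix_poly_def by (intro exI[of _ "\<lambda>k l. transpose (C l k)"]) auto
qed

lemma bivariate_row_poly:
  fixes R :: "complex \<Rightarrow> complex \<Rightarrow> complex^'r^'r"
  assumes "bivariate_matrix_poly N R"
  shows "(\<lambda>z. u v* R w z) \<in> vector_polys N"
  using bivariate_column_poly[OF bivariate_transposed[OF assms], of w u]
  by (simp add: transposed_kernel_def)

text \<open>
  The two reproducing properties of the Christoffel--Darboux kernel, for single row and column
  polynomials and tested against a vector, so that all integrals are scalar.
\<close>

definition reproduces_rows where
  "reproduces_rows \<Gamma> W N (R :: complex \<Rightarrow> complex \<Rightarrow> complex^'r^'r) \<longleftrightarrow>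
     (\<forall>P \<in> vector_polys N. \<forall>z v. has_integral_along
        (\<lambda>w. scalar_product (P w) (W w *v (R w z *v v))) (scalar_product (P z) v) \<Gamma>)"

definition reproduces_columns where
  "reproduces_columns \<Gamma> W N (R :: complex \<Rightarrow> complex \<Rightarrow> complex^'r^'r) \<longleftrightarrow>
     (\<forall>Q \<in> vector_polys N. \<forall>w u. has_integral_along
        (\<lambda>z. scalar_product u (R w z *v (W z *v Q z))) (scalar_product u (Q w)) \<Gamma>)"

lemma reproduces_rows_transposed:
  "reproduces_rows \<Gamma> (\<lambda>w. transpose (W w)) N (transposed_kernel R) \<longleftrightarrow> reproduces_columns \<Gamma> W N R"
proof -
  have "scalar_product (P w) (transpose (W w) *v (transposed_kernel R w z *v v)) =
      scalar_product v (R z w *v (W w *v P w))" for P w z v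
    unfolding scalar_product_matrix_vector[of "P w"] transposed_kernel_def
    by (simp add: scalar_product_matrix_vector[of v] scalar_product_commute[of "W w *v P w"])
  then show ?thesis
    unfolding reproduces_rows_def reproduces_columns_def
    by (simp add: scalar_product_commute)
qed

text \<open>
  A row polynomial is fed in as a matrix polynomial with all rows equal to it (and a column
  polynomial as one with all columns equal), and any one row (column) of the result is read off.
\<close>

lemma CD_kernel_reproduces:
  fixes R :: "complex \<Rightarrow> complex \<Rightarrow> complex^'r^'r"
  assumes "is_CD_kernel \<Gamma> W N R"
  shows "reproduces_rows \<Gamma> W N R \<or> reproduces_columns \<Gamma> W N R"
proof -
  consider
    (rows) "\<And>P z. P \<in> matrix_polys N \<Longrightarrow>
       has_matrix_integral_along (\<lambda>w. P w ** W w ** R w z) (P z :: complex^'r^'r) \<Gamma>" |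
    (columns) "\<And>Q w. Q \<in> matrix_polys N \<Longrightarrow>
       has_matrix_integral_along (\<lambda>z. R w z ** W z ** Q z) (Q w :: complex^'r^'r) \<Gamma>"
    using assms unfolding is_CD_kernel_def by blast
  then show ?thesis
  proof cases
    case rows
    have "has_integral_along (\<lambda>w. scalar_product (P w) (W w *v (R w z *v v)))
        (scalar_product (P z) v) \<Gamma>" if P: "P \<in> vector_polys N" for P z v
    proof -
      define M where "M = (\<lambda>w. \<chi> i::'r. P w)"
      obtain C where "P = (\<lambda>z. \<chi> i. \<Sum>l<N. C l $ i * z ^ l)"
        using P unfolding vector_polys_def by blast
      then have "M \<in> matrix_polys N"
        unfolding matrix_polys_def M_def by (auto intro!: exI[of _ "\<lambda>l. \<chi> i. C l"])
      from rows[OF this] have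
        "has_integral_along (\<lambda>w. (M w ** W w ** R w z) $ undefined $ j) (M z $ undefined $ j) \<Gamma>" for j
        unfolding has_matrix_integral_along_def by blast
      then have "has_integral_along (\<lambda>w. \<Sum>j\<in>UNIV. v $ j * (M w ** W w ** R w z) $ undefined $ j)
          (\<Sum>j\<in>UNIV. v $ j * M z $ undefined $ j) \<Gamma>"
        by (intro has_integral_along_sum) auto
      moreover have "(M w ** K) $ i = P w v* K" for w i and K :: "complex^'r^'r"
        by (simp add: M_def matrix_matrix_mult_def vector_matrix_mult_def vec_eq_iff mult.commute)
      then have "(\<Sum>j\<in>UNIV. v $ j * (M w ** W w ** R w z) $ undefined $ j) =
          scalar_product (P w) (W w *v (R w z *v v))" for w
        by (simp add: matrix_mul_assoc[symmetric] matrix_vector_mul_assoc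
          scalar_product_matrix_vector scalar_product_commute[of _ v])
          (simp add: scalar_product_def)
      moreover have "(\<Sum>j\<in>UNIV. v $ j * M z $ undefined $ j) = scalar_product (P z) v"
        by (simp add: M_def scalar_product_def mult.commute)
      ultimately show ?thesis by simp
    qed
    then show ?thesis
      unfolding reproduces_rows_def by blast
  next
    case columns
    have "has_integral_along (\<lambda>z. scalar_product u (R w z *v (W z *v Q z)))
        (scalar_product u (Q w)) \<Gamma>" if Q: "Q \<in> vector_polys N" for Q w u
    proof -
      define M where "M = (\<lambda>z. \<chi> i. \<chi> j::'r. Q z $ i)"
      obtain C where "Q = (\<lambda>z. \<chi> i. \<Sum>l<N. C l $ i * z ^ l)"
        using Q unfolding vector_polys_def by blast
      then have "M \<in> matrix_polys N"
        unfolding matrix_polys_def M_def by (auto intro!: exI[of _ "\<lambda>l. \<chi> i j. C l $ i"])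
      from columns[OF this] have
        "has_integral_along (\<lambda>z. (R w z ** W z ** M z) $ i $ undefined) (M w $ i $ undefined) \<Gamma>" for i
        unfolding has_matrix_integral_along_def by blast
      then have "has_integral_along (\<lambda>z. \<Sum>i\<in>UNIV. u $ i * (R w z ** W z ** M z) $ i $ undefined)
          (\<Sum>i\<in>UNIV. u $ i * M w $ i $ undefined) \<Gamma>"
        by (intro has_integral_along_sum) auto
      moreover have "(K ** M z) $ i $ j = (K *v Q z) $ i" for z i j and K :: "complex^'r^'r"
        by (simp add: M_def matrix_matrix_mult_def matrix_vector_mult_def)
      then have "(\<Sum>i\<in>UNIV. u $ i * (R w z ** W z ** M z) $ i $ undefined) =
          scalar_product u (R w z *v (W z *v Q z))" for z
        by (simp add: matrix_vector_mul_assoc scalar_product_def)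
      moreover have "(\<Sum>i\<in>UNIV. u $ i * M w $ i $ undefined) = scalar_product u (Q w)"
        by (simp add: M_def scalar_product_def)
      ultimately show ?thesis by simp
    qed
    then show ?thesis
      unfolding reproduces_columns_def by blast
  qed
qed

text \<open>
  A relation between the columns remains a relation after integration against \<open>P W\<close>, where
  reproduction turns the column \<open>j\<close> of \<open>R(\<cdot>, i)\<close> into entry \<open>j\<close> of \<open>P(i)\<close>.  A polynomial \<open>P\<close> of
  degree \<open>N - 1\<close> that is nonzero in one entry at one node only isolates a single coefficient.
\<close>

lemma kernel_columns_independent:
  fixes R :: "complex \<Rightarrow> complex \<Rightarrow> complex^'r^'r"
  assumes rep: "reproduces_rows \<Gamma> W N R"
  shows "independent_family (UNIV \<times> {..<N}) (\<lambda>(j, i) (w, k). R w (of_nat i) $ k $ j)"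
  unfolding independent_family_def
proof (intro allI impI ballI)
  fix a and ji0 :: "'r \<times> nat"
  assume 0: "\<forall>x. (\<Sum>ji\<in>UNIV \<times> {..<N}. a ji *
      (case ji of (j, i) \<Rightarrow> \<lambda>(w, k). R w (of_nat i) $ k $ j) x) = 0"
    and "ji0 \<in> UNIV \<times> {..<N}"
  then obtain j0 i0 where ji0: "ji0 = (j0, i0)" "i0 < N"
    by auto
  \<comment> \<open>An unnormalised Lagrange polynomial for the nodes \<open>0, \<dots>, N - 1\<close>.\<close>
  define p :: "complex poly" where "p = (\<Prod>m\<in>{..<N} - {i0}. [:- of_nat m, 1:])"
  have "degree p \<le> (\<Sum>m\<in>{..<N} - {i0}. 1)"
    unfolding p_def by (rule order_trans[OF degree_prod_sum_le]) (auto intro!: sum_mono)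
  then have "degree p < N"
    using ji0(2) by simp
  define P where "P = (\<lambda>z. \<chi> k. (axis j0 1 :: complex^'r) $ k * poly p z)"
  have P: "P \<in> vector_polys N"
    unfolding P_def using \<open>degree p < N\<close> by (rule vector_polys_poly)
  have p: "poly p (of_nat i) = 0 \<longleftrightarrow> i \<noteq> i0" if "i < N" for i
    using that by (auto simp: p_def poly_prod)
  have "has_integral_along (\<lambda>w. \<Sum>ji\<in>UNIV \<times> {..<N}. a ji *
       scalar_product (P w) (W w *v (R w (of_nat (snd ji)) *v axis (fst ji) 1)))
      (\<Sum>ji\<in>UNIV \<times> {..<N}. a ji * scalar_product (P (of_nat (snd ji))) (axis (fst ji) 1)) \<Gamma>"
    using rep P unfolding reproduces_rows_def
    by (intro has_integral_along_sum) (auto simp del: scalar_product_axis)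
  moreover have "(\<Sum>ji\<in>UNIV \<times> {..<N}. a ji *
       scalar_product (P w) (W w *v (R w (of_nat (snd ji)) *v axis (fst ji) 1))) = 0" for w
  proof -
    have "(\<chi> k. \<Sum>ji\<in>UNIV \<times> {..<N}. a ji * (R w (of_nat (snd ji)) *v axis (fst ji) 1) $ k) = 0"
      using 0[rule_format, of "(w, _)"]
      by (simp add: vec_eq_iff case_prod_beta matrix_vector_axis)
    then show ?thesis
      by (simp add: scalar_product_matrix_vector[of "P w"] scalar_product_sum_right[symmetric])
        (simp add: scalar_product_def)
  qed
  moreover have "has_integral_along (\<lambda>_. 0) 0 \<Gamma>"
    using has_integral_along_sum[of "{}"] by simp
  ultimately have "(\<Sum>ji\<in>UNIV \<times> {..<N}. a ji * P (of_nat (snd ji)) $ fst ji) = 0"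
    using has_integral_along_unique by fastforce
  moreover have "(\<Sum>ji\<in>UNIV \<times> {..<N}. a ji * P (of_nat (snd ji)) $ fst ji) =
      (\<Sum>ji\<in>{ji0}. a ji * P (of_nat (snd ji)) $ fst ji)"
    using ji0 p by (intro sum.mono_neutral_right) (auto simp: P_def axis_def)
  ultimately show "a ji0 = 0"
    using p[OF ji0(2)] by (simp add: P_def ji0(1))
qed

text \<open>
  The kernel columns are \<open>r * N\<close> independent elements of a space that is spanned by \<open>r * N\<close>
  monomials.
\<close>

lemma column_poly_in_kernel_span:
  fixes R :: "complex \<Rightarrow> complex \<Rightarrow> complex^'r^'r"
  assumes R: "bivariate_matrix_poly N R" and rep: "reproduces_rows \<Gamma> W N R"
    and Q: "Q \<in> vector_polys N"
  shows "\<exists>a. Q = (\<lambda>w. \<chi> k. \<Sum>ji\<in>UNIV \<times> {..<N}. a ji *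
    (R w (of_nat (snd ji)) *v axis (fst ji) 1) $ k)"
proof -
  \<comment> \<open>Column polynomials are themselves a space \<^const>\<open>L_space\<close>, over the trivial surface made of \<open>r\<close>
     disjoint planes, with constant unit vectors as \<open>e\<close>.\<close>
  define e :: "complex \<times> 'r \<Rightarrow> complex^'r" where "e = (\<lambda>(w, k). axis k 1)"
  define b where "b = (\<lambda>(j, i) (w, k). R w (of_nat i) $ k $ j)"
  have col: "(\<lambda>(w, k). Q w $ k) \<in> L_space N UNIV (\<lambda>(w, k). Some w) e"
    if "Q \<in> vector_polys N" for Q :: "complex \<Rightarrow> complex^'r"
    using that unfolding L_space_def
    by (auto simp: on_domain_def e_def fun_eq_iff intro!: exI[of _ Q])
  let ?basis = "(\<lambda>(k, l). on_domain UNIV (\<lambda>p. the ((\<lambda>(w, k). Some w) p) ^ l * e p $ k)) ` (UNIV \<times> {..<N})"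
  have "b ` (UNIV \<times> {..<N}) \<subseteq> L_space N UNIV (\<lambda>(w, k). Some w) e"
  proof clarify
    fix j i
    have "b (j, i) = (\<lambda>(w, k). (R w (of_nat i) *v axis j 1) $ k)"
      by (simp add: b_def fun_eq_iff matrix_vector_axis)
    then show "b (j, i) \<in> L_space N UNIV (\<lambda>(w, k). Some w) e"
      using col[OF bivariate_column_poly[OF R]] by simp
  qed
  moreover have "independent_family (UNIV \<times> {..<N}) b"
    unfolding b_def using rep by (rule kernel_columns_independent)
  moreover have "card ?basis \<le> card ((UNIV :: 'r set) \<times> {..<N})"
    by (rule card_image_le) simp
  ultimately have "L_space N UNIV (\<lambda>(w, k). Some w) e \<subseteq> function_space.span (b ` (UNIV \<times> {..<N}))"
    unfolding L_space_eq_span by (intro independent_family_spans) auto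
  then have "(\<lambda>(w, k). Q w $ k) \<in> function_space.span (b ` (UNIV \<times> {..<N}))"
    using col[OF Q] by blast
  then obtain a where a: "(\<lambda>(w, k). Q w $ k) = (\<lambda>x. \<Sum>ji\<in>UNIV \<times> {..<N}. a ji * b ji x)"
    by (subst (asm) span_family) auto
  have "Q w $ k = (\<Sum>ji\<in>UNIV \<times> {..<N}. a ji * (R w (of_nat (snd ji)) *v axis (fst ji) 1) $ k)" for w k
    using fun_cong[OF a, of "(w, k)"]
    by (simp add: b_def case_prod_beta matrix_vector_axis)
  then show ?thesis
    by (intro exI[of _ a]) (simp add: fun_eq_iff vec_eq_iff)
qed

text \<open>
  It suffices to consider \<open>Q = R(\<cdot>, z') v\<close>, and for these the claim is the reproduction of the
  row polynomial \<open>u R(w, \<cdot>)\<close> at \<open>z'\<close>.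
\<close>

lemma reproduces_rows_imp_columns:
  fixes R :: "complex \<Rightarrow> complex \<Rightarrow> complex^'r^'r"
  assumes R: "bivariate_matrix_poly N R" and rep: "reproduces_rows \<Gamma> W N R"
  shows "reproduces_columns \<Gamma> W N R"
  unfolding reproduces_columns_def
proof (intro ballI allI)
  fix Q :: "complex \<Rightarrow> complex^'r" and w u
  assume "Q \<in> vector_polys N"
  from column_poly_in_kernel_span[OF R rep this] obtain a where
    Q: "Q = (\<lambda>z. \<chi> k. \<Sum>ji\<in>UNIV \<times> {..<N}. a ji *
      (R z (of_nat (snd ji)) *v axis (fst ji) 1) $ k)" ..
  have row: "has_integral_along (\<lambda>z. scalar_product (u v* R w z) (W z *v (R z z' *v v)))
      (scalar_product (u v* R w z') v) \<Gamma>" for z' v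
    by (rule bspec[OF rep[unfolded reproduces_rows_def] bivariate_row_poly[OF R, of u w], rule_format])
  have "has_integral_along (\<lambda>z. \<Sum>ji\<in>UNIV \<times> {..<N}. a ji *
       scalar_product (u v* R w z) (W z *v (R z (of_nat (snd ji)) *v axis (fst ji) 1)))
      (\<Sum>ji\<in>UNIV \<times> {..<N}. a ji *
       scalar_product (u v* R w (of_nat (snd ji))) (axis (fst ji) 1)) \<Gamma>"
    by (intro has_integral_along_sum row) simp
  then show "has_integral_along (\<lambda>z. scalar_product u (R w z *v (W z *v Q z))) (scalar_product u (Q w)) \<Gamma>"
    unfolding scalar_product_matrix_vector Q scalar_product_sum_right .
qed

lemma CD_kernel_reproduces_rows_and_columns:
  fixes R :: "complex \<Rightarrow> complex \<Rightarrow> complex^'r^'r"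
  assumes "is_CD_kernel \<Gamma> W N R"
  shows "reproduces_rows \<Gamma> W N R" and "reproduces_columns \<Gamma> W N R"
proof -
  have R: "bivariate_matrix_poly N R"
    using assms by (simp add: is_CD_kernel_def)
  have "reproduces_rows \<Gamma> W N R" if "reproduces_columns \<Gamma> W N R"
  proof -
    have "reproduces_columns \<Gamma> (\<lambda>w. transpose (W w)) N (transposed_kernel R)"
      by (intro reproduces_rows_imp_columns bivariate_transposed R)
        (simp add: reproduces_rows_transposed that)
    then have "reproduces_rows \<Gamma> (\<lambda>w. transpose (transpose (W w))) N
        (transposed_kernel (transposed_kernel R))"
      unfolding reproduces_rows_transposed .
    then show ?thesis
      by (simp add: transposed_kernel_def[abs_def])
  qed
  then show "reproduces_rows \<Gamma> W N R" "reproduces_columns \<Gamma> W N R"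
    using CD_kernel_reproduces[OF assms] reproduces_rows_imp_columns[OF R] by blast+
qed

section \<open>Poles on a compact Riemann surface\<close>

text \<open>
  Transfers germs at a point from chart coordinates to the surface, where germs from different
  charts can be compared.
\<close>

lemma punctured_chart_neighbourhood:
  assumes X: "riemann_surface X A" "(U, \<phi>) \<in> A" "p \<in> U"
    and P: "eventually P (at (\<phi> p))"
  shows "\<exists>V. openin X V \<and> p \<in> V \<and> V \<subseteq> U \<and> (\<forall>q\<in>V - {p}. P (\<phi> q))"
proof -
  have U: "openin X U" and hom: "homeomorphic_map (subtopology X U) (top_of_set (\<phi> ` U)) \<phi>"
    using X unfolding riemann_surface_def by auto
  then have top: "topspace (subtopology X U) = U"
    by (simp add: openin_subset Int_absorb1)
  obtain S where S: "open S" "\<phi> p \<in> S" "\<And>x. x \<in> S \<Longrightarrow> x \<noteq> \<phi> p \<Longrightarrow> P x"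
    using P unfolding eventually_at_topological by auto
  define V where "V = {q \<in> U. \<phi> q \<in> S}"
  have "openin (subtopology X U) {q \<in> topspace (subtopology X U). \<phi> q \<in> \<phi> ` U \<inter> S}"
    using homeomorphic_imp_continuous_map[OF hom] S(1)
    by (intro openin_continuous_map_preimage) (auto simp: openin_open)
  moreover have "{q \<in> topspace (subtopology X U). \<phi> q \<in> \<phi> ` U \<inter> S} = V"
    unfolding top V_def by auto
  ultimately have "openin X V"
    using U openin_trans_full by metis
  moreover have "inj_on \<phi> U"
    using homeomorphic_imp_injective_map[OF hom] unfolding top .
  then have "\<forall>q\<in>V - {p}. P (\<phi> q)"
    using S(3) X(3) by (auto simp: V_def inj_on_def)
  ultimately show ?thesis
    using S(2) X(3) by (intro exI[of _ V]) (auto simp: V_def)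
qed

lemma riemann_surface_no_isolated_point:
  assumes "riemann_surface X A" "p \<in> topspace X"
  shows "\<not> openin X {p}"
proof
  assume p: "openin X {p}"
  obtain U \<phi> where U: "(U, \<phi>) \<in> A" "p \<in> U"
    using assms unfolding riemann_surface_def by blast
  then have hom: "homeomorphic_map (subtopology X U) (top_of_set (\<phi> ` U)) \<phi>" "open (\<phi> ` U)"
    using assms(1) unfolding riemann_surface_def by auto
  have "openin (subtopology X U) {p}"
    using p U(2) by (auto simp: openin_subtopology intro: exI[of _ "{p}"])
  then have "openin (top_of_set (\<phi> ` U)) (\<phi> ` {p})"
    using homeomorphic_imp_open_map[OF hom(1)] unfolding open_map_def by blast
  then have "open {\<phi> p}"
    using hom(2) openin_open_trans by fastforce
  then show False
    using not_open_singleton by blast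
qed

text \<open>
  \<^const>\<open>pole_at\<close> asks for a pole in some chart.  Being a pole does not depend on the chart: otherwise
  \<open>f\<close> would be bounded on one punctured neighbourhood of \<open>p\<close> and large on another one, so that these
  are disjoint and \<open>p\<close> is isolated.
\<close>

lemma pole_at_chart:
  assumes X: "riemann_surface X A" and f: "meromorphic_fun A f"
    and U: "(U, \<phi>) \<in> A" "p \<in> U" and p: "pole_at A f p"
  shows "is_pole (f \<circ> inv_into U \<phi>) (\<phi> p)"
proof (rule ccontr)
  assume no: "\<not> is_pole (f \<circ> inv_into U \<phi>) (\<phi> p)"
  have inj: "inj_on \<psi> V" if "(V, \<psi>) \<in> A" for V \<psi>
  proof -
    have "openin X V" "homeomorphic_map (subtopology X V) (top_of_set (\<psi> ` V)) \<psi>"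
      using X that unfolding riemann_surface_def by auto
    then show ?thesis
      using homeomorphic_imp_injective_map openin_subset topspace_subtopology_subset by metis
  qed
  obtain c where "(f \<circ> inv_into U \<phi>) \<midarrow>\<phi> p\<rightarrow> c"
    using f U no unfolding meromorphic_fun_def nicely_meromorphic_on_def by blast
  then have "((\<lambda>x. norm ((f \<circ> inv_into U \<phi>) x)) \<longlongrightarrow> norm c) (at (\<phi> p))"
    by (rule tendsto_norm)
  then have "eventually (\<lambda>x. norm ((f \<circ> inv_into U \<phi>) x) < norm c + 1) (at (\<phi> p))"
    by (rule order_tendstoD) simp
  from punctured_chart_neighbourhood[OF X U this] obtain O1 where
    O1: "openin X O1" "p \<in> O1" "O1 \<subseteq> U"
      "\<And>q. q \<in> O1 - {p} \<Longrightarrow> norm (f (inv_into U \<phi> (\<phi> q))) < norm c + 1"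
    by auto
  obtain V \<psi> where V: "(V, \<psi>) \<in> A" "p \<in> V" "is_pole (f \<circ> inv_into V \<psi>) (\<psi> p)"
    using p unfolding pole_at_def by auto
  then have "eventually (\<lambda>x. norm ((f \<circ> inv_into V \<psi>) x) \<ge> norm c + 1) (at (\<psi> p))"
    unfolding is_pole_def filterlim_at_infinity_conv_norm_at_top filterlim_at_top by blast
  from punctured_chart_neighbourhood[OF X V(1,2) this] obtain O2 where
    O2: "openin X O2" "p \<in> O2" "O2 \<subseteq> V"
      "\<And>q. q \<in> O2 - {p} \<Longrightarrow> norm (f (inv_into V \<psi> (\<psi> q))) \<ge> norm c + 1"
    by auto
  have "O1 \<inter> O2 \<subseteq> {p}"
  proof
    fix q assume q: "q \<in> O1 \<inter> O2"
    then have "inv_into U \<phi> (\<phi> q) = q" "inv_into V \<psi> (\<psi> q) = q"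
      using O1(3) O2(3) inj U V by (auto intro!: inv_into_f_f)
    then show "q \<in> {p}"
      using O1(4)[of q] O2(4)[of q] q by force
  qed
  then have "O1 \<inter> O2 = {p}"
    using O1(2) O2(2) by auto
  then have "openin X {p}"
    using O1(1) O2(1) openin_Int by metis
  moreover have "p \<in> topspace X"
    using O1 openin_subset by blast
  ultimately show False
    using riemann_surface_no_isolated_point[OF X] by blast
qed

text \<open>
  Cover the surface by neighbourhoods with at most one pole each, and pass to a finite subcover.
\<close>

lemma finite_poles:
  assumes X: "riemann_surface X A" "compact_space X" and f: "meromorphic_fun A f"
  shows "finite {p \<in> topspace X. pole_at A f p}"
proof -
  have "\<exists>V. openin X V \<and> p \<in> V \<and> (\<forall>q\<in>V - {p}. \<not> pole_at A f q)" if p: "p \<in> topspace X" for p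
  proof -
    obtain U \<phi> where U: "(U, \<phi>) \<in> A" "p \<in> U"
      using X(1) p unfolding riemann_surface_def by blast
    then have "(f \<circ> inv_into U \<phi>) meromorphic_on \<phi> ` U"
      using f unfolding meromorphic_fun_def nicely_meromorphic_on_def by blast
    then have "isolated_singularity_at (f \<circ> inv_into U \<phi>) (\<phi> p)"
        "not_essential (f \<circ> inv_into U \<phi>) (\<phi> p)"
      using U(2) meromorphic_onE by blast+
    then have "eventually (\<lambda>x. \<not> is_pole (f \<circ> inv_into U \<phi>) x) (at (\<phi> p))"
      by (intro eventually_not_pole)
    from punctured_chart_neighbourhood[OF X(1) U this] obtain V where
      V: "openin X V" "p \<in> V" "V \<subseteq> U" "\<forall>q\<in>V - {p}. \<not> is_pole (f \<circ> inv_into U \<phi>) (\<phi> q)"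
      by blast
    then have "\<forall>q\<in>V - {p}. \<not> pole_at A f q"
      using pole_at_chart[OF X(1) f U(1)] by blast
    with V show ?thesis by blast
  qed
  then have "\<forall>p. \<exists>V. p \<in> topspace X \<longrightarrow>
      openin X V \<and> p \<in> V \<and> (\<forall>q\<in>V - {p}. \<not> pole_at A f q)"
    by blast
  from choice[OF this] obtain V where V: "\<And>p. p \<in> topspace X \<Longrightarrow> openin X (V p)"
      "\<And>p. p \<in> topspace X \<Longrightarrow> p \<in> V p"
      "\<And>p q. p \<in> topspace X \<Longrightarrow> q \<in> V p - {p} \<Longrightarrow> \<not> pole_at A f q"
    by blast
  have "(\<forall>U \<in> V ` topspace X. openin X U) \<and> topspace X \<subseteq> \<Union>(V ` topspace X)"
    using V(1,2) by blast
  then obtain \<F> where \<F>: "finite \<F>" "\<F> \<subseteq> V ` topspace X" "topspace X \<subseteq> \<Union>\<F>"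
    using X(2)[unfolded compact_space_alt, rule_format, of "V ` topspace X"] by blast
  obtain T where T: "T \<subseteq> topspace X" "finite T" "\<F> = V ` T"
    using finite_subset_image[OF \<F>(1,2)] by blast
  have "{p \<in> topspace X. pole_at A f p} \<subseteq> T"
    using \<F>(3) T(1,3) V(3) by blast
  then show ?thesis
    using T(2) finite_subset by blast
qed

lemma finite_vector_poles:
  fixes f :: "'m \<Rightarrow> complex^'r"
  assumes "riemann_surface X A" "compact_space X" "\<And>i. meromorphic_fun A (\<lambda>p. f p $ i)"
  shows "finite (vector_poles X A f)"
proof -
  have "vector_poles X A f = (\<Union>i. {p \<in> topspace X. pole_at A (\<lambda>p. f p $ i) p})"
    by (auto simp: vector_poles_def)
  then show ?thesis
    using assms by (simp add: finite_poles)
qed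

section \<open>Spectral decomposition over a generic point\<close>

lemma diag_matrix_mult_vector:
  fixes d :: "complex^'r"
  shows "(diag_matrix d *v x) $ k = d $ k * x $ k"
  by (simp add: diag_matrix_def matrix_vector_mult_def if_distrib[of "\<lambda>c. c * _"] cong: if_cong)

text \<open>
  With \<open>F = matrix_inv E\<close>, summation over the sheets turns the scalar weight \<open>ev\<close>, placed between
  \<open>e\<close> and \<open>eh\<close>, back into the matrix weight.
\<close>

lemma spectral_sum:
  fixes E F :: "complex^'r^'r"
  shows "(\<Sum>k\<in>UNIV. scalar_product u (E *v axis k 1) * d $ k * scalar_product (axis k 1 v* F) v) =
    scalar_product u ((E ** diag_matrix d ** F) *v v)"
proof -
  have "scalar_product (axis k 1 v* F) v = (F *v v) $ k" for k
    by (simp only: scalar_product_matrix_vector[symmetric] scalar_product_axis_left)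
  then show ?thesis
    by (simp add: matrix_vector_mul_assoc[symmetric] scalar_product_matrix_vector[of u E])
      (simp add: scalar_product_def diag_matrix_mult_vector mult.assoc)
qed

lemma matrix_inv_right:
  fixes E :: "complex^'r^'r"
  assumes "invertible E"
  shows "E ** matrix_inv E = mat 1"
  using assms unfolding invertible_def matrix_inv_def by (rule someI2_ex) blast

lemma columns_of_invertible_separate:
  fixes E :: "complex^'r^'r"
  assumes "invertible E" and 0: "\<And>k. scalar_product v (E *v axis k 1) = 0"
  shows "v = 0"
proof -
  have "v v* E = 0"
    using 0 by (simp add: scalar_product_matrix_vector vec_eq_iff)
  then have "scalar_product v (E *v (matrix_inv E *v axis k 1)) = 0" for k
    by (simp add: scalar_product_matrix_vector[of v E]) (simp add: scalar_product_def)
  then have "v $ k = 0" for k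
    using matrix_inv_right[OF assms(1)] by (simp add: matrix_vector_mul_assoc)
  then show ?thesis
    by (simp add: vec_eq_iff)
qed

lemma rows_of_inverse_separate:
  fixes E :: "complex^'r^'r"
  assumes "invertible E" and 0: "\<And>k. scalar_product v (axis k 1 v* matrix_inv E) = 0"
  shows "v = 0"
proof -
  have "(matrix_inv E *v v) $ k = 0" for k
    using 0[of k]
    by (simp add: scalar_product_commute[of v] scalar_product_matrix_vector[symmetric])
  then have "matrix_inv E *v v = 0"
    by (simp add: vec_eq_iff)
  then have "E *v (matrix_inv E *v v) = 0"
    by simp
  then show ?thesis
    using matrix_inv_right[OF assms(1)] by (simp add: matrix_vector_mul_assoc)
qed

lemma Lhat_space_eq_L_space: "Lhat_space N D \<pi> eh = L_space N D \<pi> eh"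
  unfolding Lhat_space_def L_space_def by (simp add: scalar_product_commute)

section \<open>The scalar kernel on the surface\<close>

theorem theorem1p5:
  fixes \<Gamma> :: "curve list"
    and W :: "complex \<Rightarrow> complex^'r^'r"
    and N :: nat
    and RW :: "complex \<Rightarrow> complex \<Rightarrow> complex^'r^'r"
    and X :: "'m topology" and A :: "'m atlas" and \<pi> :: "'m \<Rightarrow> complex option"
    and s :: "'r \<Rightarrow> complex \<Rightarrow> 'm"
    and E :: "complex \<Rightarrow> complex^'r^'r" and d :: "complex \<Rightarrow> complex^'r"
    and ev :: "'m \<Rightarrow> complex" and e eh :: "'m \<Rightarrow> complex^'r"
  defines "D \<equiv> finite_points X \<pi> - vector_poles X A e"
    and "Dh \<equiv> finite_points X \<pi> - vector_poles X A eh"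
  defines "L \<equiv> L_space N D \<pi> e"
    and "Lh \<equiv> Lhat_space N Dh \<pi> eh"
  assumes "piecewise_smooth_contour \<Gamma>"
    and "rational_matrix W"
    and "N > 0"
    and "\<forall>z \<in> contour_image \<Gamma>. \<not> matrix_has_pole W z"
    and "finite {z. \<not> diagonalizable (W z)}"
    and "is_CD_kernel \<Gamma> W N RW"
    and "sheeted_covering CARD('r) X A \<pi>"
    and "sheet_numbering X \<pi> s"
    and "spectral_data W s E d ev e eh"
    and "meromorphic_fun A ev"
    and "\<forall>i. meromorphic_fun A (\<lambda>p. e p $ i)"
    and "\<forall>i. meromorphic_fun A (\<lambda>p. eh p $ i)"
  shows "\<exists>K.
    (\<forall>w \<in> Dh. \<forall>z \<in> D. K w z = scalar_product (eh w) (RW (the (\<pi> w)) (the (\<pi> z)) *v e z)) \<and>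
    complex_dim L = CARD('r) * N \<and> complex_dim Lh = CARD('r) * N \<and>
    (\<forall>w \<in> Dh. on_domain D (\<lambda>z. K w z) \<in> L) \<and>
    (\<forall>z \<in> D. on_domain Dh (\<lambda>w. K w z) \<in> Lh) \<and>
    (\<forall>f \<in> L. \<forall>z \<in> D. has_integral_on_sheets (\<lambda>w. f w * ev w * K w z) (f z) s \<Gamma>) \<and>
    (\<forall>f \<in> Lh. \<forall>w \<in> Dh. has_integral_on_sheets (\<lambda>z. K w z * ev z * f z) (f w) s \<Gamma>)"
proof -
  obtain F where F: "finite F"
    and inv: "\<And>z. z \<notin> F \<Longrightarrow> invertible (E z)"
    and Wz: "\<And>z. z \<notin> F \<Longrightarrow> W z = E z ** diag_matrix (d z) ** matrix_inv (E z)"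
    and ev: "\<And>z k. z \<notin> F \<Longrightarrow> ev (s k z) = d z $ k"
    and e: "\<And>z k. z \<notin> F \<Longrightarrow> e (s k z) = E z *v axis k 1"
    and eh: "\<And>z k. z \<notin> F \<Longrightarrow> eh (s k z) = axis k 1 v* matrix_inv (E z)"
    using \<open>spectral_data W s E d ev e eh\<close> unfolding spectral_data_def by blast
  \<comment> \<open>The values \<open>0\<close> that functions in \<open>L\<close> and \<open>Lh\<close> take off their domains occur on the sheets only
     over \<open>B\<close>, so the sums over the sheets are complete elsewhere.\<close>
  define B where "B = F \<union> (\<lambda>p. the (\<pi> p)) ` (vector_poles X A e \<union> vector_poles X A eh)"
  have X: "riemann_surface X A" "compact_space X"
    using \<open>sheeted_covering CARD('r) X A \<pi>\<close> by (simp_all add: sheeted_covering_def)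
  have "finite (vector_poles X A e)" "finite (vector_poles X A eh)"
    using X assms(14-16) by (auto intro!: finite_vector_poles)
  with F have B: "finite B"
    by (simp add: B_def)
  then have B': "infinite (- B)"
    by (metis finite_compl infinite_UNIV_char_0)
  have s: "\<pi> (s k z) = Some z" "s k z \<in> topspace X" for k z
    using \<open>sheet_numbering X \<pi> s\<close> unfolding sheet_numbering_def by blast+
  have notF: "z \<notin> F" if "z \<notin> B" for z
    using that by (simp add: B_def)
  have in_D: "s k z \<in> D" "s k z \<in> Dh" if "z \<notin> B" for z k
    using that s[of k z] unfolding B_def D_def Dh_def finite_points_def by force+
  have sum_sheets: "(\<Sum>k\<in>UNIV. scalar_product u (e (s k z)) * ev (s k z) * scalar_product (eh (s k z)) v) =
      scalar_product u (W z *v v)" if "z \<notin> B" for z u v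
    using notF[OF that] by (simp add: ev e eh Wz spectral_sum)
  define K where "K w z = scalar_product (eh w) (RW (the (\<pi> w)) (the (\<pi> z)) *v e z)" for w z
  have RW: "bivariate_matrix_poly N RW"
    using \<open>is_CD_kernel \<Gamma> W N RW\<close> by (simp add: is_CD_kernel_def)
  note rep = CD_kernel_reproduces_rows_and_columns[OF \<open>is_CD_kernel \<Gamma> W N RW\<close>]
  have dimL: "complex_dim L = CARD('r) * N"
    unfolding L_def
  proof (rule dim_L_space[OF B'])
    fix z and v :: "complex^'r"
    assume z: "z \<in> - B" and 0: "\<And>p. p \<in> D \<Longrightarrow> \<pi> p = Some z \<Longrightarrow> scalar_product v (e p) = 0"
    then have "scalar_product v (E z *v axis k 1) = 0" for k
      using 0[of "s k z"] in_D[of z k] s[of k z] notF[of z] by (simp add: e)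
    then show "v = 0"
      using columns_of_invertible_separate inv notF z by blast
  qed
  have dimLh: "complex_dim Lh = CARD('r) * N"
    unfolding Lh_def Lhat_space_eq_L_space
  proof (rule dim_L_space[OF B'])
    fix z and v :: "complex^'r"
    assume z: "z \<in> - B" and 0: "\<And>p. p \<in> Dh \<Longrightarrow> \<pi> p = Some z \<Longrightarrow> scalar_product v (eh p) = 0"
    then have "scalar_product v (axis k 1 v* matrix_inv (E z)) = 0" for k
      using 0[of "s k z"] in_D[of z k] s[of k z] notF[of z] by (simp add: eh)
    then show "v = 0"
      using rows_of_inverse_separate inv notF z by blast
  qed
  have K_L: "on_domain D (\<lambda>z. K w z) \<in> L" for w
    unfolding L_def L_space_def K_def scalar_product_matrix_vector
    using bivariate_row_poly[OF RW, of "eh w" "the (\<pi> w)"]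
    by (auto intro!: exI[of _ "\<lambda>z. eh w v* RW (the (\<pi> w)) z"])
  have K_Lh: "on_domain Dh (\<lambda>w. K w z) \<in> Lh" for z
    unfolding Lh_def Lhat_space_def K_def
    using bivariate_column_poly[OF RW, of "the (\<pi> z)" "e z"]
    by (auto intro!: exI[of _ "\<lambda>w. RW w (the (\<pi> z)) *v e z"])
  have rep_L: "has_integral_on_sheets (\<lambda>w. f w * ev w * K w z) (f z) s \<Gamma>"
    if f: "f \<in> L" and z: "z \<in> D" for f z
  proof -
    obtain P where P: "P \<in> vector_polys N"
      and fP: "f = on_domain D (\<lambda>p. scalar_product (P (the (\<pi> p))) (e p))"
      using f unfolding L_def L_space_def by blast
    have "(\<Sum>k\<in>UNIV. f (s k w) * ev (s k w) * K (s k w) z) =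
        scalar_product (P w) (W w *v (RW w (the (\<pi> z)) *v e z))" if w: "w \<notin> B" for w
      using in_D[OF w] sum_sheets[OF w, symmetric]
      by (simp add: fP on_domain_def s K_def)
    moreover have "has_integral_along (\<lambda>w. scalar_product (P w) (W w *v (RW w (the (\<pi> z)) *v e z)))
        (f z) \<Gamma>"
      using rep(1) P z unfolding reproduces_rows_def by (simp add: fP on_domain_def)
    ultimately show ?thesis
      unfolding has_integral_on_sheets_def
      by (rule has_integral_along_spike[OF \<open>piecewise_smooth_contour \<Gamma>\<close> B])
  qed
  have rep_Lh: "has_integral_on_sheets (\<lambda>z. K w z * ev z * f z) (f w) s \<Gamma>"
    if f: "f \<in> Lh" and w: "w \<in> Dh" for f w
  proof -
    obtain Q where Q: "Q \<in> vector_polys N"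
      and fQ: "f = on_domain Dh (\<lambda>p. scalar_product (eh p) (Q (the (\<pi> p))))"
      using f unfolding Lh_def Lhat_space_def by blast
    have "(\<Sum>k\<in>UNIV. K w (s k z) * ev (s k z) * f (s k z)) =
        scalar_product (eh w) (RW (the (\<pi> w)) z *v (W z *v Q z))" if z: "z \<notin> B" for z
      using in_D[OF z] sum_sheets[OF z, of "eh w v* RW (the (\<pi> w)) z"]
      by (simp add: fQ on_domain_def s K_def scalar_product_matrix_vector[of "eh w"])
    moreover have "has_integral_along
        (\<lambda>z. scalar_product (eh w) (RW (the (\<pi> w)) z *v (W z *v Q z))) (f w) \<Gamma>"
      using rep(2) Q w unfolding reproduces_columns_def by (simp add: fQ on_domain_def)
    ultimately show ?thesis
      unfolding has_integral_on_sheets_def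
      by (rule has_integral_along_spike[OF \<open>piecewise_smooth_contour \<Gamma>\<close> B])
  qed
  show ?thesis
    using dimL dimLh K_L K_Lh rep_L rep_Lh by (intro exI[of _ K]) (simp add: K_def)
qed

end
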